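(* Let $\bm{s}_1=[2,0]^{T}$, $\bm{s}_2=[0,2]^{T}$, $\bm{s}_3=[1,1]^{T}$, $\bm{s}_4=[1,-1]^{T}$, with row matrix $$R_1=\begin{bmatrix} 2 & 0 & 1 & 1\\ 0 & 2 & 1 & -1\end{bmatrix}.$$ Let $\bm{F}_1$ and $\bm{F}_2$ be the two prime Kirchhoff graphs for $R_1$ of edge multiplicity $2$, i.e. the two (up to translation) Kirchhoff graphs for $R_1$ with multiplicity at most $m_{\max}=2$. Then the set $\langle \bm{F}_1,\bm{F}_2\rangle$ of Kirchhoff graphs obtainable by tiling $\bm{F}_1$ and $\bm{F}_2$ contains infinitely many prime Kirchhoff graphs.
   Context: Let $S=\{\bm{s}_1,\dots,\bm{s}_n\}$ be edge vectors in a vector space over $\mathbb{Q}$, no one a scalar multiple of another, with $\{\bm{s}_1,\dots,\bm{s}_k\}$ a basis of $\mathrm{Span}(S)$ ($1<k<n$). Write $[\bm{s}_1,\dots,\bm{s}_n]\,[C'/-I_{n-k}]=0$. Let $q$ be the least common multiple of the denominators of $C'$ and $C=qC'$. The row matrix is $R=[qI_k\,|\,C]$ and the null matrix is $N=[C/-qI_{n-k}]$, whose columns form a basis of $\mathrm{Null}(R)$. The columns of $R$ represent the vectors of $S$; for the vectors above, $R=R_1$. A vector graph is a finite directed graph whose vertices are points of $\mathbb{Z}^k$ and each of whose edges is a copy of some $\bm{s}_i$, running from a point $p$ to $p+\bm{s}_i$ (using the column representation). Multiple copies of the same edge are allowed. For a vertex $v$, the vertex cut $\bm{\lambda}(v)\in\mathbb{Z}^n$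 has $i$-th entry equal to the number of copies of $\bm{s}_i$ leaving $v$ minus the number entering $v$. For a cycle $C$ (a closed walk repeating no vertex except its first/last), the cycle vector $\bm{\chi}(C)\in\mathbb{Z}^n$ has $i$-th entry equal to the number of copies of $\bm{s}_i$ traversed forward minus the number traversed backward. A Kirchhoff graph for $R$ is a vector graph satisfying two conditions: - for every vertex $v$, $\bm{\lambda}(v)\in\mathrm{Row}(R)$; - for every cycle $C$, $\bm{\chi}(C)\in\mathrm{Null}(R)$, and some cycle basis of the cycle space corresponds to a basis of $\mathrm{Null}(R)$. All Kirchhoff graphs considered are vector 2-connected: for any two edge vectors $\bm{s}_i,\bm{s}_j$ there is a cycle whose cycle vector is nonzero in both entries $i$ and $j$. Such graphs are uniform, meaning each $\bm{s}_i$ appears the same number $m$ of times; $m$ is the (edge) multiplicity. Sum: $(\bm{G}_1+\bm{G}_2,\bm{x})$ for $\bm{x}\in\mathbb{Z}^k$ is the union, with all edge copies counted, of $\bm{G}_1$ with its anchor vertex at the origin and $\bm{G}_2$ with its anchor vertex at $\bm{x}$. Multiplicities add, and only sums preserving vector 2-connectivity are considered. Difference: $(\bm{G}_1-\bm{G}_2,\bm{x})$ removes a copy of $\bm{G}_2$, anchored at $\bm{x}$, that occurs as a subgraph of $\bm{G}_1$. Tiling: repeatedly adding and/or subtracting Kirchhoff graphs is a tiling. $\langle \bm{G}_1,\dots,\bm{G}_N\rangle=\{a_1\bm{G}_1+\dots+a_N\bm{G}_N : a_i\in\mathbb{Z}\}$ is the set of all Kirchhoff graphs constructible by such tilings, with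 arbitrary anchor positions. A negative $a_i$ is allowed only when $|a_i|$ copies of $\bm{G}_i$ are present to remove. Prime: a Kirchhoff graph is prime if it cannot be written as $\bm{G}_1+\bm{G}_2$ with both $\bm{G}_1,\bm{G}_2$ nontrivial Kirchhoff graphs, i.e. it has no nontrivial Kirchhoff subgraph decomposition. *)

theory Defs
  imports "HOL-Analysis.Analysis" "HOL-Library.Multiset" "HOL-Library.Function_Algebras"
begin

section \<open>Row and null spaces of an integer matrix\<close>

definition Row :: "int ^ 'n ^ 'k \<Rightarrow> (rat ^ 'n) set" where
  "Row R = vec.span (rows (map_matrix rat_of_int R))"

definition Null :: "int ^ 'n ^ 'k \<Rightarrow> (rat ^ 'n) set" where
  "Null R = {x. map_matrix rat_of_int R *v x = 0}"

definition rat_vec :: "int ^ 'n \<Rightarrow> rat ^ 'n" where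
  "rat_vec x = (\<chi> i. rat_of_int (x $ i))"


section \<open>Vector graphs\<close>

text \<open>
  A vector graph is the finite multiset of its edges. The pair \<open>(p, i)\<close> stands for a copy of
  the \<open>i\<close>-th edge vector \<open>column i R\<close> running from \<open>p\<close> to \<open>p + column i R\<close>. The vertices are the
  end points of the edges, so there are no isolated vertices.
\<close>

type_synonym ('n, 'k) vector_graph = "((int ^ 'k) \<times> 'n) multiset"

definition vertices :: "int ^ 'n ^ 'k \<Rightarrow> ('n, 'k) vector_graph \<Rightarrow> (int ^ 'k) set" where
  "vertices R G = (\<Union>(p, i) \<in> set_mset G. {p, p + column i R})"

definition vertex_cut ::
    "int ^ 'n ^ 'k \<Rightarrow> ('n, 'k) vector_graph \<Rightarrow> int ^ 'k \<Rightarrow> int ^ 'n" where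
  "vertex_cut R G v = (\<chi> i. int (count G (v, i)) - int (count G (v - column i R, i)))"


section \<open>Cycles\<close>

text \<open>
  Parallel copies of an edge are told apart by a number. In a step \<open>(e, d)\<close> of a walk, the edge
  copy \<open>e\<close> is traversed forward if \<open>d\<close> holds and backward otherwise.
\<close>

type_synonym ('n, 'k) edge_copy = "((int ^ 'k) \<times> 'n) \<times> nat"
type_synonym ('n, 'k) walk = "(('n, 'k) edge_copy \<times> bool) list"

definition edge_copies :: "('n, 'k) vector_graph \<Rightarrow> ('n, 'k) edge_copy set" where
  "edge_copies G = {(e, c). c < count G e}"

fun step_start :: "int ^ 'n ^ 'k \<Rightarrow> ('n, 'k) edge_copy \<times> bool \<Rightarrow> int ^ 'k" where
  "step_start R (((p, i), c), d) = (if d then p else p + column i R)"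

fun step_end :: "int ^ 'n ^ 'k \<Rightarrow> ('n, 'k) edge_copy \<times> bool \<Rightarrow> int ^ 'k" where
  "step_end R (((p, i), c), d) = (if d then p + column i R else p)"

text \<open>
  No edge copy is used twice: going along an edge copy and straight back is not a cycle,
  whereas two distinct parallel copies do form a cycle of length 2.
\<close>

definition is_cycle :: "int ^ 'n ^ 'k \<Rightarrow> ('n, 'k) vector_graph \<Rightarrow> ('n, 'k) walk \<Rightarrow> bool" where
  "is_cycle R G w \<longleftrightarrow>
     w \<noteq> [] \<and>
     fst ` set w \<subseteq> edge_copies G \<and>
     (\<forall>j < length w. step_end R (w ! j) = step_start R (w ! (Suc j mod length w))) \<and>
     distinct (map (step_start R) w) \<and>
     distinct (map fst w)"

definition cycle_vector :: "('n, 'k) walk \<Rightarrow> int ^ 'n" where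
  "cycle_vector w = (\<chi> i.
     int (length (filter (\<lambda>(((p, j), c), d). j = i \<and> d) w)) -
     int (length (filter (\<lambda>(((p, j), c), d). j = i \<and> \<not> d) w)))"


section \<open>The cycle space\<close>

definition edge_scale :: "rat \<Rightarrow> ('e \<Rightarrow> rat) \<Rightarrow> 'e \<Rightarrow> rat" where
  "edge_scale a f = (\<lambda>e. a * f e)"

interpretation edge_space: vector_space "edge_scale :: rat \<Rightarrow> ('e \<Rightarrow> rat) \<Rightarrow> 'e \<Rightarrow> rat"
  by unfold_locales (auto simp: edge_scale_def fun_eq_iff algebra_simps)

definition edge_incidence :: "('n, 'k) walk \<Rightarrow> ('n, 'k) edge_copy \<Rightarrow> rat" where
  "edge_incidence w e = of_nat (count_list w (e, True)) - of_nat (count_list w (e, False))"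

definition cycle_space ::
    "int ^ 'n ^ 'k \<Rightarrow> ('n, 'k) vector_graph \<Rightarrow> (('n, 'k) edge_copy \<Rightarrow> rat) set" where
  "cycle_space R G = edge_space.span (edge_incidence ` {w. is_cycle R G w})"

definition is_cycle_basis ::
    "int ^ 'n ^ 'k \<Rightarrow> ('n, 'k) vector_graph \<Rightarrow> ('n, 'k) walk set \<Rightarrow> bool" where
  "is_cycle_basis R G B \<longleftrightarrow>
     (\<forall>w \<in> B. is_cycle R G w) \<and>
     inj_on edge_incidence B \<and>
     edge_space.independent (edge_incidence ` B) \<and>
     edge_space.span (edge_incidence ` B) = cycle_space R G"


section \<open>Kirchhoff graphs\<close>

text \<open>
  The cycle space is usually of larger dimension than the null space (parallel copies and
  repeated shapes contribute cycles with zero or equal cycle vectors). Hence a cycle basis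
  corresponds to a basis of the null space if the cycle vectors of some of its members form one.
\<close>

definition basis_corresponds ::
    "int ^ 'n ^ 'k \<Rightarrow> ('n, 'k) walk set \<Rightarrow> bool" where
  "basis_corresponds R B \<longleftrightarrow>
     (\<exists>B' \<subseteq> B.
        inj_on cycle_vector B' \<and>
        vec.independent ((rat_vec \<circ> cycle_vector) ` B') \<and>
        vec.span ((rat_vec \<circ> cycle_vector) ` B') = Null R)"

definition vector_2_connected :: "int ^ 'n ^ 'k \<Rightarrow> ('n, 'k) vector_graph \<Rightarrow> bool" where
  "vector_2_connected R G \<longleftrightarrow>
     (\<forall>i j. i \<noteq> j \<longrightarrow>
        (\<exists>w. is_cycle R G w \<and> cycle_vector w $ i \<noteq> 0 \<and> cycle_vector w $ j \<noteq> 0))"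

definition kirchhoff_graph :: "int ^ 'n ^ 'k \<Rightarrow> ('n, 'k) vector_graph \<Rightarrow> bool" where
  "kirchhoff_graph R G \<longleftrightarrow>
     (\<forall>v \<in> vertices R G. rat_vec (vertex_cut R G v) \<in> Row R) \<and>
     (\<forall>w. is_cycle R G w \<longrightarrow> rat_vec (cycle_vector w) \<in> Null R) \<and>
     (\<exists>B. is_cycle_basis R G B \<and> basis_corresponds R B) \<and>
     vector_2_connected R G"

definition edge_multiplicity :: "('n, 'k) vector_graph \<Rightarrow> nat \<Rightarrow> bool" where
  "edge_multiplicity G m \<longleftrightarrow> (\<forall>i. size (filter_mset (\<lambda>e. snd e = i) G) = m)"


section \<open>Sums, differences and tilings\<close>

definition translate :: "int ^ 'k \<Rightarrow> ('n, 'k) vector_graph \<Rightarrow> ('n, 'k) vector_graph" where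
  "translate x G = image_mset (\<lambda>(p, i). (p + x, i)) G"

definition translation_rel :: "(('n, 'k::finite) vector_graph \<times> ('n, 'k) vector_graph) set" where
  "translation_rel = {(G, H). \<exists>x. H = translate x G}"

text \<open>
  The position of a graph in the lattice plays the role of its anchor. As \<open>x\<close> ranges over the
  whole lattice, the choice of the anchor vertex has no effect.
\<close>

definition graph_sum ::
    "('n, 'k) vector_graph \<Rightarrow> ('n, 'k) vector_graph \<Rightarrow> int ^ 'k \<Rightarrow> ('n, 'k) vector_graph" where
  "graph_sum G\<^sub>1 G\<^sub>2 x = G\<^sub>1 + translate x G\<^sub>2"

definition graph_diff ::
    "('n, 'k) vector_graph \<Rightarrow> ('n, 'k) vector_graph \<Rightarrow> int ^ 'k \<Rightarrow> ('n, 'k) vector_graph" where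
  "graph_diff G\<^sub>1 G\<^sub>2 x = G\<^sub>1 - translate x G\<^sub>2"

inductive_set tilings ::
    "int ^ 'n ^ 'k \<Rightarrow> ('n, 'k) vector_graph set \<Rightarrow> ('n, 'k) vector_graph set"
  for R :: "int ^ 'n ^ 'k" and Fs :: "('n, 'k) vector_graph set" where
  place: "F \<in> Fs \<Longrightarrow> kirchhoff_graph R (translate x F) \<Longrightarrow> translate x F \<in> tilings R Fs"
| add: "G \<in> tilings R Fs \<Longrightarrow> F \<in> Fs \<Longrightarrow> kirchhoff_graph R (graph_sum G F x) \<Longrightarrow>
    graph_sum G F x \<in> tilings R Fs"
| remove: "G \<in> tilings R Fs \<Longrightarrow> F \<in> Fs \<Longrightarrow> translate x F \<subseteq># G \<Longrightarrow>
    kirchhoff_graph R (graph_diff G F x) \<Longrightarrow> graph_diff G F x \<in> tilings R Fs"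

definition prime_kirchhoff :: "int ^ 'n ^ 'k \<Rightarrow> ('n, 'k) vector_graph \<Rightarrow> bool" where
  "prime_kirchhoff R G \<longleftrightarrow>
     kirchhoff_graph R G \<and> G \<noteq> {#} \<and>
     \<not> (\<exists>G\<^sub>1 G\<^sub>2 x. kirchhoff_graph R G\<^sub>1 \<and> kirchhoff_graph R G\<^sub>2 \<and>
          G\<^sub>1 \<noteq> {#} \<and> G\<^sub>2 \<noteq> {#} \<and> G = graph_sum G\<^sub>1 G\<^sub>2 x)"

text \<open>
  \<open>F\<^sub>1\<close> and \<open>F\<^sub>2\<close> are prime of edge multiplicity \<open>m\<close>, and up to translation they are the two
  Kirchhoff graphs for \<open>R\<close> of edge multiplicity at most \<open>m\<close>.
\<close>

definition the_two_kirchhoff ::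
    "int ^ 'n ^ 'k \<Rightarrow> nat \<Rightarrow> ('n, 'k) vector_graph \<Rightarrow> ('n, 'k) vector_graph \<Rightarrow> bool" where
  "the_two_kirchhoff R m F\<^sub>1 F\<^sub>2 \<longleftrightarrow>
     prime_kirchhoff R F\<^sub>1 \<and> edge_multiplicity F\<^sub>1 m \<and>
     prime_kirchhoff R F\<^sub>2 \<and> edge_multiplicity F\<^sub>2 m \<and>
     (F\<^sub>1, F\<^sub>2) \<notin> translation_rel \<and>
     (\<forall>G. kirchhoff_graph R G \<and> (\<exists>m' \<le> m. edge_multiplicity G m') \<longrightarrow>
        (F\<^sub>1, G) \<in> translation_rel \<or> (F\<^sub>2, G) \<in> translation_rel)"

definition R\<^sub>1 :: "int ^ 4 ^ 2" where
  "R\<^sub>1 = vector [vector [2, 0, 1,  1],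
               vector [0, 2, 1, -1]]"

end

theory Submission
  imports Defs
begin

text \<open>
  A vector \<open>(l\<^sub>1, l\<^sub>2, l\<^sub>3, l\<^sub>4)\<close> lies in the row space of \<open>R\<^sub>1\<close> iff \<open>l\<^sub>1 = l\<^sub>3 + l\<^sub>4\<close> and \<open>l\<^sub>2 = l\<^sub>3 - l\<^sub>4\<close>.
  Contracting one edge vector at a time, these cut equations determine the projections of the
  edge sources onto four lines; at multiplicity two they leave exactly two graphs, a unit cell
  \<open>F\<^sub>1\<close> with doubled diagonals and a rhombus \<open>F\<^sub>2\<close> around a plus, and at multiplicity one none.
  Copies of \<open>F\<^sub>2\<close> at the points of an \<open>n \<times> 2\<close> rectangle cover the cells inside it, and removing
  a copy of \<open>F\<^sub>1\<close> for each of them leaves a thin closed band. In the band the cut equations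
  propagate from one edge to all others, so it has no proper balanced subgraph and is prime; its
  size grows with \<open>n\<close>.
\<close>

subsection \<open>The matrix and the lattice\<close>

lemma vector_4 [simp]:
  "(vector [x, y, z, w] :: ('a::zero)^4) $ 1 = x"
  "(vector [x, y, z, w] :: ('a::zero)^4) $ 2 = y"
  "(vector [x, y, z, w] :: ('a::zero)^4) $ 3 = z"
  "(vector [x, y, z, w] :: ('a::zero)^4) $ 4 = w"
  by (simp_all add: vector_def)

text \<open>Coordinates with respect to \<open>s\<^sub>3\<close> and \<open>s\<^sub>4\<close> on the sublattice spanned by the edge vectors.\<close>

definition grid :: "int \<Rightarrow> int \<Rightarrow> int ^ 2" where
  "grid i j = vector [i + j, i - j]"

lemma grid_nth [simp]: "grid i j $ 1 = i + j" "grid i j $ 2 = i - j"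
  by (simp_all add: grid_def)

lemma grid_eq_iff [simp]: "grid i j = grid i' j' \<longleftrightarrow> i = i' \<and> j = j'"
  by (auto simp: vec_eq_iff forall_2)

lemma grid_add [simp]: "grid i j + grid i' j' = grid (i + i') (j + j')"
  by (auto simp: vec_eq_iff forall_2)

lemma grid_diff [simp]: "grid i j - grid i' j' = grid (i - i') (j - j')"
  by (auto simp: vec_eq_iff forall_2)

lemma column_R\<^sub>1 [simp]:
  "column 1 R\<^sub>1 = grid 1 1" "column 2 R\<^sub>1 = grid 1 (-1)"
  "column 3 R\<^sub>1 = grid 1 0" "column 4 R\<^sub>1 = grid 0 1"
  by (simp_all add: vec_eq_iff forall_2 column_def R\<^sub>1_def)

lemma Row_R\<^sub>1_iff:
  "rat_vec x \<in> Row R\<^sub>1 \<longleftrightarrow> x $ 1 = x $ 3 + x $ 4 \<and> x $ 2 = x $ 3 - x $ 4"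
proof -
  have "rows (map_matrix rat_of_int R\<^sub>1) = {vector [2, 0, 1, 1], vector [0, 2, 1, -1]}"
  proof -
    have "rows A = {row 1 A, row 2 A}" for A :: "rat ^ 4 ^ 2"
      unfolding rows_def by (auto, metis exhaust_2)
    then show ?thesis
      by (simp add: row_def R\<^sub>1_def map_matrix_def)
         (intro arg_cong2[where f = insert] refl; simp add: vec_eq_iff forall_4)
  qed
  then have "rat_vec x \<in> Row R\<^sub>1 \<longleftrightarrow>
      (\<exists>a b. rat_vec x - a *s vector [2, 0, 1, 1] = b *s vector [0, 2, 1, -1])"
    by (auto simp: Row_def vec.span_breakdown_eq)
  also have "\<dots> \<longleftrightarrow> rat_of_int (x $ 1) = of_int (x $ 3 + x $ 4) \<and> rat_of_int (x $ 2) = of_int (x $ 3 - x $ 4)"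
    (is "?L \<longleftrightarrow> ?R")
  proof
    assume ?L then show ?R
      by (auto simp: vec_eq_iff forall_4 rat_vec_def algebra_simps)
  next
    \<comment> \<open>The first two columns of the matrix are twice the identity, so the
      coefficients must be half the first two entries.\<close>
    assume ?R then show ?L
      by (intro exI[of _ "of_int (x $ 1) / 2"] exI[of _ "of_int (x $ 2) / 2"])
         (simp add: vec_eq_iff forall_4 rat_vec_def field_simps)
  qed
  finally show ?thesis by (simp only: of_int_eq_iff)
qed

lemma Null_R\<^sub>1_iff:
  "x \<in> Null R\<^sub>1 \<longleftrightarrow> 2 * x $ 1 + x $ 3 + x $ 4 = 0 \<and> 2 * x $ 2 + x $ 3 - x $ 4 = 0"
  by (simp add: Null_def vec_eq_iff forall_2 matrix_vector_mult_def sum_4 R\<^sub>1_def map_matrix_def algebra_simps)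


subsection \<open>Cycles\<close>

text \<open>The values \<open>b j\<close> are those of \<open>a\<close> read in cyclic order, so
  both sums have the same terms.\<close>

lemma telescoping_cyclic_sum:
  fixes a b :: "nat \<Rightarrow> 'a::ab_group_add"
  assumes "n > 0" "\<And>j. j < n \<Longrightarrow> b j = a (Suc j mod n)"
  shows "(\<Sum>j<n. b j - a j) = 0"
proof -
  obtain m where m: "n = Suc m" using assms(1) by (cases n) auto
  have "(\<Sum>j<n. b j) = (\<Sum>j<n. a (Suc j mod n))"
    using assms(2) by (intro sum.cong) auto
  also have "\<dots> = (\<Sum>j<m. a (Suc j)) + a 0"
    by (simp add: m)
  also have "\<dots> = (\<Sum>j<n. a j)"
    unfolding m sum.lessThan_Suc_shift by (simp add: add.commute)
  finally show ?thesis by (simp add: sum_subtractf)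
qed

text \<open>Each step moves by plus or minus a column. The identity holds for every list of steps,
  which lets the induction run.\<close>

lemma sum_step_displacements:
  "(\<Sum>s\<leftarrow>w. step_end R s - step_start R s) =
     (\<Sum>i\<in>UNIV. cycle_vector w $ i *s column i R)"
proof (induction w)
  case Nil
  then show ?case by (simp add: cycle_vector_def)
next
  case (Cons s w)
  obtain p k c d where s: "s = (((p, k), c), d)" by (metis surj_pair)
  have *: "cycle_vector (s # w) $ i *s column i R =
      cycle_vector w $ i *s column i R + (if i = k then step_end R s - step_start R s else 0)" for i
    by (auto simp: s cycle_vector_def vec_eq_iff algebra_simps)
  show ?case
    unfolding * sum.distrib using Cons.IH by (simp add: add.commute)
qed

lemma cycle_vector_in_Null:
  assumes "is_cycle R G w"
  shows "rat_vec (cycle_vector w) \<in> Null R"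
proof -
  have "(\<Sum>s\<leftarrow>w. step_end R s - step_start R s) =
      (\<Sum>j<length w. step_end R (w ! j) - step_start R (w ! j))"
    by (simp add: sum_list_sum_nth atLeast0LessThan)
  also have "\<dots> = 0"
    using assms by (intro telescoping_cyclic_sum) (auto simp: is_cycle_def)
  finally have "(\<Sum>i\<in>UNIV. cycle_vector w $ i *s column i R) = 0"
    by (simp add: sum_step_displacements)
  then have "(\<Sum>i\<in>UNIV. R $ k $ i * cycle_vector w $ i) = 0" for k
    by (auto simp: vec_eq_iff column_def mult.commute dest!: spec[of _ k])
  then have "rat_of_int (\<Sum>i\<in>UNIV. R $ k $ i * cycle_vector w $ i) = 0" for k
    by simp
  then show ?thesis
    by (simp add: Null_def vec_eq_iff matrix_vector_mult_def rat_vec_def map_matrix_def)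
qed

lemma is_cycle_mono:
  assumes "is_cycle R G w" "G \<subseteq># H"
  shows "is_cycle R H w"
proof -
  have "edge_copies G \<subseteq> edge_copies H"
    using mset_subset_eq_count[OF assms(2)] by (fastforce simp: edge_copies_def intro: less_le_trans)
  then show ?thesis using assms(1) by (auto simp: is_cycle_def)
qed

section \<open>Triangles whose cycle vectors span the null space\<close>

definition fwd :: "int \<Rightarrow> int \<Rightarrow> 4 \<Rightarrow> (4, 2) edge_copy \<times> bool" where
  "fwd i j k = (((grid i j, k), 0), True)"

definition bwd :: "int \<Rightarrow> int \<Rightarrow> 4 \<Rightarrow> (4, 2) edge_copy \<times> bool" where
  "bwd i j k = (((grid i j, k), 0), False)"

text \<open>The digits name the edge vectors: this cycle expresses
  \<open>s\<^sub>2 = s\<^sub>3 - s\<^sub>4\<close>, and \<open>triangle_134\<close> expresses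
  \<open>s\<^sub>1 = s\<^sub>3 + s\<^sub>4\<close>.\<close>

definition triangle_234 :: "int \<Rightarrow> int \<Rightarrow> (4, 2) walk" where
  "triangle_234 i j = [fwd i j 4, fwd i (j + 1) 2, bwd i j 3]"

definition triangle_134 :: "int \<Rightarrow> int \<Rightarrow> (4, 2) walk" where
  "triangle_134 i j = [fwd i j 1, bwd (i + 1) j 4, bwd i j 3]"

lemma cycle_vector_triangle:
  "cycle_vector (triangle_234 i j) = vector [0, 1, -1, 1]"
  "cycle_vector (triangle_134 i j) = vector [1, 0, -1, -1]"
  by (simp_all add: vec_eq_iff forall_4 cycle_vector_def triangle_234_def triangle_134_def
      fwd_def bwd_def)

lemma is_cycle_triangle_234:
  assumes "(grid i j, 4) \<in># G" "(grid i (j + 1), 2) \<in># G" "(grid i j, 3) \<in># G"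
  shows "is_cycle R\<^sub>1 G (triangle_234 i j)"
  using assms
  by (auto simp: is_cycle_def triangle_234_def fwd_def bwd_def edge_copies_def less_Suc_eq)

lemma is_cycle_triangle_134:
  assumes "(grid i j, 1) \<in># G" "(grid (i + 1) j, 4) \<in># G" "(grid i j, 3) \<in># G"
  shows "is_cycle R\<^sub>1 G (triangle_134 i j)"
  using assms
  by (auto simp: is_cycle_def triangle_134_def fwd_def bwd_def edge_copies_def less_Suc_eq)

text \<open>The edge \<open>?e\<close> occurs only in the first triangle and \<open>?e'\<close> only
  in the second, wherever the two lie.\<close>

lemma independent_triangles:
  "edge_space.independent {edge_incidence (triangle_234 i j), edge_incidence (triangle_134 i' j')}"
  "edge_incidence (triangle_234 i j) \<noteq> edge_incidence (triangle_134 i' j')"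
proof -
  let ?a = "edge_incidence (triangle_234 i j)" and ?b = "edge_incidence (triangle_134 i' j')"
  let ?e = "((grid i (j + 1), 2), 0) :: (4, 2) edge_copy"
  let ?e' = "((grid i' j', 1), 0) :: (4, 2) edge_copy"
  have inc: "?a ?e = 1" "?a ?e' = 0" "?b ?e = 0" "?b ?e' = 1"
    by (auto simp: edge_incidence_def triangle_234_def triangle_134_def fwd_def bwd_def)
  show "?a \<noteq> ?b" using inc by force
  have "?a \<notin> edge_space.span {?b}"
  proof
    assume "?a \<in> edge_space.span {?b}"
    then obtain k where "?a = edge_scale k ?b"
      by (auto simp: edge_space.span_singleton)
    then have "?a ?e = k * ?b ?e" by (simp add: edge_scale_def)
    with inc show False by simp
  qed
  moreover have "?b \<noteq> 0" using inc by (metis zero_fun_apply zero_neq_one)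
  ultimately show "edge_space.independent {?a, ?b}"
    by (auto simp: edge_space.independent_insert)
qed

lemma independent_triangle_vectors:
  "vec.independent {vector [0, 1, -1, 1] :: rat ^ 4, vector [1, 0, -1, -1]}"
  by (auto simp: vec.independent_insert vec.span_singleton vec_eq_iff forall_4)

lemma Null_R\<^sub>1_span: "Null R\<^sub>1 = vec.span {vector [0, 1, -1, 1], vector [1, 0, -1, -1]}"
proof -
  have "x \<in> Null R\<^sub>1 \<longleftrightarrow> (\<exists>a b. x - a *s vector [0, 1, -1, 1] = b *s vector [1, 0, -1, -1])"
    (is "?L \<longleftrightarrow> ?R") for x
  proof
    assume ?L then show ?R
      by (intro exI[of _ "x $ 2"] exI[of _ "x $ 1"])
         (simp add: Null_R\<^sub>1_iff vec_eq_iff forall_4)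
  next
    assume ?R then show ?L
      by (auto simp: Null_R\<^sub>1_iff vec_eq_iff forall_4 algebra_simps)
  qed
  then show ?thesis by (auto simp: vec.span_breakdown_eq)
qed

lemma rat_vec_triangle:
  "rat_vec (cycle_vector (triangle_234 i j)) = vector [0, 1, -1, 1]"
  "rat_vec (cycle_vector (triangle_134 i j)) = vector [1, 0, -1, -1]"
  by (simp_all add: cycle_vector_triangle rat_vec_def vec_eq_iff forall_4)

text \<open>The two triangles are independent and their cycle vectors form a basis of the null
  space, so any cycle basis extending them will do.\<close>

lemma corresponding_cycle_basis:
  assumes "is_cycle R\<^sub>1 G (triangle_234 i j)" "is_cycle R\<^sub>1 G (triangle_134 i' j')"
  shows "\<exists>B. is_cycle_basis R\<^sub>1 G B \<and> basis_corresponds R\<^sub>1 B"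
proof -
  let ?w = "triangle_234 i j" and ?w' = "triangle_134 i' j'"
  let ?C = "{w. is_cycle R\<^sub>1 G w}"
  obtain I where I: "{edge_incidence ?w, edge_incidence ?w'} \<subseteq> I" "I \<subseteq> edge_incidence ` ?C"
      "edge_space.independent I" "edge_incidence ` ?C \<subseteq> edge_space.span I"
  proof (rule edge_space.maximal_independent_subset_extend[OF _ independent_triangles(1)])
    show "{edge_incidence ?w, edge_incidence ?w'} \<subseteq> edge_incidence ` ?C" using assms by auto
  qed
  \<comment> \<open>An arbitrary inverse might return another walk with the same incidence vector;
    the updates make it return the triangles themselves.\<close>
  define g where "g = (inv_into ?C edge_incidence)
      (edge_incidence ?w := ?w, edge_incidence ?w' := ?w')"
  have g: "g f \<in> ?C" "edge_incidence (g f) = f" if "f \<in> I" for f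
    using that I(2) assms inv_into_into[of f edge_incidence ?C] f_inv_into_f[of f edge_incidence ?C]
    by (auto simp: g_def)
  have image: "edge_incidence ` g ` I = I"
    using g by force
  have "edge_space.span I = cycle_space R\<^sub>1 G"
    unfolding cycle_space_def
    using I(2,4) edge_space.span_mono[OF I(2)] edge_space.span_minimal[OF I(4)]
    by (intro antisym) auto
  then have "is_cycle_basis R\<^sub>1 G (g ` I)"
    unfolding is_cycle_basis_def image using g I(3) by (auto intro!: inj_onI)
  moreover have "{?w, ?w'} \<subseteq> g ` I"
  proof -
    have "g (edge_incidence ?w) = ?w" "g (edge_incidence ?w') = ?w'"
      using independent_triangles(2) by (auto simp: g_def)
    then show ?thesis using I(1) by (auto simp: image_iff) metis+
  qed
  then have "basis_corresponds R\<^sub>1 (g ` I)"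
    unfolding basis_corresponds_def
  proof (intro exI conjI)
    show "inj_on cycle_vector {?w, ?w'}"
      by (auto simp: inj_on_def cycle_vector_triangle vec_eq_iff forall_4)
    have "(rat_vec \<circ> cycle_vector) ` {?w, ?w'} = {vector [0, 1, -1, 1], vector [1, 0, -1, -1]}"
      by (simp add: rat_vec_triangle)
    then show "vec.independent ((rat_vec \<circ> cycle_vector) ` {?w, ?w'})"
        "vec.span ((rat_vec \<circ> cycle_vector) ` {?w, ?w'}) = Null R\<^sub>1"
      by (simp_all only: independent_triangle_vectors Null_R\<^sub>1_span not_False_eq_True)
  qed
  ultimately show ?thesis by blast
qed


subsection \<open>Kirchhoff graphs\<close>

text \<open>Stated at all lattice points, since the cut vanishes off the vertices; in this form
  balance is linear in the graph.\<close>

definition balanced :: "(4, 2) vector_graph \<Rightarrow> bool" where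
  "balanced G \<longleftrightarrow> (\<forall>v. let l = vertex_cut R\<^sub>1 G v in l $ 1 = l $ 3 + l $ 4 \<and> l $ 2 = l $ 3 - l $ 4)"

lemma vertex_cut_outside:
  assumes "v \<notin> vertices R G"
  shows "vertex_cut R G v = 0"
proof -
  have "(v, i) \<notin># G" "(v - column i R, i) \<notin># G" for i
    using assms by (force simp: vertices_def)+
  then have "count G (v, i) = 0" "count G (v - column i R, i) = 0" for i
    by (simp_all add: count_eq_zero_iff)
  then show ?thesis by (simp add: vertex_cut_def vec_eq_iff)
qed

lemma balanced_iff: "balanced G \<longleftrightarrow> (\<forall>v \<in> vertices R\<^sub>1 G. rat_vec (vertex_cut R\<^sub>1 G v) \<in> Row R\<^sub>1)"
  unfolding balanced_def Row_R\<^sub>1_iff Let_def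
  by (metis vertex_cut_outside zero_index add_0 diff_self)

lemma kirchhoff_balanced: "kirchhoff_graph R\<^sub>1 G \<Longrightarrow> balanced G"
  by (simp add: kirchhoff_graph_def balanced_iff)

text \<open>The triangles serve the index pairs within {2, 3, 4} and {1, 3, 4}, the third cycle the
  remaining pair {1, 2}. This property passes to larger graphs.\<close>

definition cycle_rich :: "(4, 2) vector_graph \<Rightarrow> bool" where
  "cycle_rich G \<longleftrightarrow>
     (\<exists>i j. is_cycle R\<^sub>1 G (triangle_234 i j)) \<and> (\<exists>i j. is_cycle R\<^sub>1 G (triangle_134 i j)) \<and>
     (\<exists>w. is_cycle R\<^sub>1 G w \<and> cycle_vector w $ 1 \<noteq> 0 \<and> cycle_vector w $ 2 \<noteq> 0)"

lemma cycle_rich_mono: "cycle_rich G \<Longrightarrow> G \<subseteq># H \<Longrightarrow> cycle_rich H"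
  unfolding cycle_rich_def by (meson is_cycle_mono)

lemma kirchhoffI:
  assumes "balanced G" "cycle_rich G"
  shows "kirchhoff_graph R\<^sub>1 G"
proof -
  obtain i j i' j' w where w: "is_cycle R\<^sub>1 G (triangle_234 i j)" "is_cycle R\<^sub>1 G (triangle_134 i' j')"
    "is_cycle R\<^sub>1 G w" "cycle_vector w $ 1 \<noteq> 0" "cycle_vector w $ 2 \<noteq> 0"
    using assms(2) by (auto simp: cycle_rich_def)
  have "vector_2_connected R\<^sub>1 G"
    unfolding vector_2_connected_def
  proof (intro allI impI)
    fix k l :: 4
    assume kl: "k \<noteq> l"
    have "(cycle_vector (triangle_234 i j) $ k \<noteq> 0 \<and> cycle_vector (triangle_234 i j) $ l \<noteq> 0) \<or>
      (cycle_vector (triangle_134 i' j') $ k \<noteq> 0 \<and> cycle_vector (triangle_134 i' j') $ l \<noteq> 0) \<or>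
      (cycle_vector w $ k \<noteq> 0 \<and> cycle_vector w $ l \<noteq> 0)"
      unfolding cycle_vector_triangle
      using exhaust_4[of k] exhaust_4[of l] kl w(4,5) by auto
    then show "\<exists>w. is_cycle R\<^sub>1 G w \<and> cycle_vector w $ k \<noteq> 0 \<and> cycle_vector w $ l \<noteq> 0"
      using w(1-3) by blast
  qed
  then show ?thesis
    using corresponding_cycle_basis[OF w(1,2)] assms(1)
    by (auto simp: kirchhoff_graph_def balanced_iff cycle_vector_in_Null)
qed

lemma kirchhoff_nonempty: "kirchhoff_graph R\<^sub>1 G \<Longrightarrow> G \<noteq> {#}"
proof
  assume "kirchhoff_graph R\<^sub>1 G" and e: "G = {#}"
  then have "\<exists>w. is_cycle R\<^sub>1 G w"
    unfolding kirchhoff_graph_def vector_2_connected_def by (metis zero_neq_one)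
  then show False by (auto simp: is_cycle_def edge_copies_def e)
qed

lemma vertex_cut_add: "vertex_cut R (G + H) v = vertex_cut R G v + vertex_cut R H v"
  by (simp add: vertex_cut_def vec_eq_iff)

lemma balanced_add: "balanced G \<Longrightarrow> balanced H \<Longrightarrow> balanced (G + H)"
  by (auto simp: balanced_def vertex_cut_add Let_def)

text \<open>The cut equations are linear and so survive differences; this handles the removal of a
  cell.\<close>

lemma balanced_add_cancel: "balanced (G + H) \<Longrightarrow> balanced H \<Longrightarrow> balanced G"
  unfolding balanced_def Let_def vertex_cut_add vector_add_component by (smt (verit))

lemma count_translate: "count (translate x G) (p, k) = count G (p - x, k)"
  by (induction G) (auto simp: translate_def)

lemma balanced_translate:
  assumes "balanced G" shows "balanced (translate x G)"
proof -
  have "vertex_cut R (translate x G) v = vertex_cut R G (v - x)" for v and R :: "int ^ 4 ^ 2"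
    by (simp add: vertex_cut_def vec_eq_iff count_translate diff_diff_eq add.commute)
  then show ?thesis using assms by (simp add: balanced_def)
qed


subsection \<open>Projections of balanced graphs\<close>

definition shift :: "'a::ab_group_add \<Rightarrow> 'a multiset \<Rightarrow> 'a multiset" where
  "shift s A = image_mset (\<lambda>p. p + s) A"

lemma shift_simps [simp]:
  "shift 0 A = A" "shift s (A + B) = shift s A + shift s B" "shift s (shift t A) = shift (s + t) A"
  "shift s {#} = {#}" "shift s (add_mset a A) = add_mset (a + s) (shift s A)"
  "size (shift s A) = size A"
  by (simp_all add: shift_def image_mset.compositionality o_def algebra_simps)

definition sources :: "('n, 'k) vector_graph \<Rightarrow> 'n \<Rightarrow> (int ^ 'k) multiset" where
  "sources G i = image_mset fst (filter_mset (\<lambda>e. snd e = i) G)"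

lemma count_sources: "count (sources G i) p = count G (p, i)"
  by (induction G) (auto simp: sources_def)

lemma count_shift: "count (shift s A) p = count A (p - s)"
  by (induction A) (auto simp: algebra_simps)

lemma size_sources: "edge_multiplicity G m \<longleftrightarrow> (\<forall>i. size (sources G i) = m)"
  by (simp add: edge_multiplicity_def sources_def)

lemma sources_eq_iff: "G = H \<longleftrightarrow> (\<forall>i. sources G i = sources H i)"
  by (auto simp: multiset_eq_iff count_sources)

lemma sources_translate: "sources (translate x G) i = shift x (sources G i)"
  by (simp add: multiset_eq_iff count_sources count_translate count_shift)

text \<open>Subtracted terms of the cut equations are moved across, which gives identities of
  multisets; shifting by a column turns tails into heads.\<close>

lemma balanced_iff_sources:
  "balanced G \<longleftrightarrow>
     sources G 1 + shift (grid 1 0) (sources G 3) + shift (grid 0 1) (sources G 4) =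
       shift (grid 1 1) (sources G 1) + sources G 3 + sources G 4 \<and>
     sources G 2 + shift (grid 1 0) (sources G 3) + sources G 4 =
       shift (grid 1 (-1)) (sources G 2) + sources G 3 + shift (grid 0 1) (sources G 4)"
  (is "_ \<longleftrightarrow> ?A = ?B \<and> ?C = ?D")
proof -
  have "balanced G \<longleftrightarrow> (\<forall>v. int (count ?A v) = int (count ?B v) \<and> int (count ?C v) = int (count ?D v))"
    unfolding balanced_def Let_def
    by (intro all_cong1) (auto simp: vertex_cut_def count_sources count_shift)
  then show ?thesis unfolding of_nat_eq_iff by (auto simp only: multiset_eq_iff)
qed

text \<open>The difference of the two counts is \<open>k\<close>-periodic and has finite support, so
  it vanishes.\<close>

lemma shift_cancel:
  fixes A B :: "int multiset"
  assumes eq: "A + shift k B = shift k A + B" and k: "k > 0"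
  shows "A = B"
proof (rule multiset_eqI)
  fix t
  define g where "g t = int (count A t) - int (count B t)" for t
  have "g (t - k) = g t" for t
    using arg_cong[OF eq, of "\<lambda>M. int (count M t)"] by (simp add: g_def count_shift)
  then have step: "g (t - int n * k) = g t" for n
    proof (induction n)
    case (Suc n)
    have "t - int (Suc n) * k = t - int n * k - k" by (simp add: algebra_simps)
    then show ?case using Suc \<open>\<And>t. g (t - k) = g t\<close> by metis
  qed simp
  have "\<not> inj (\<lambda>n. t - int n * k) \<or> \<not> range (\<lambda>n. t - int n * k) \<subseteq> set_mset (A + B)"
    using finite_set_mset finite_subset range_inj_infinite by blast
  moreover have "inj (\<lambda>n. t - int n * k)" using k by (auto intro: injI)
  ultimately obtain n where "t - int n * k \<notin># A + B" by blast
  then have "g (t - int n * k) = 0" by (simp add: g_def not_in_iff)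
  then have "g t = 0" by (simp only: step)
  then show "count A t = count B t" by (simp add: g_def)
qed

lemma linear_image_shift:
  assumes "\<And>p q. f (p + q) = f p + f q"
  shows "image_mset f (shift s A) = shift (f s) (image_mset f A)"
  by (simp add: shift_def image_mset.compositionality o_def assms)

text \<open>In ambient coordinates the pairs \<open>1 1\<close>, \<open>1 (-1)\<close>,
  \<open>1 0\<close> and \<open>0 1\<close> annihilate \<open>s\<^sub>4\<close>,
  \<open>s\<^sub>3\<close>, \<open>s\<^sub>2\<close> and \<open>s\<^sub>1\<close>
  respectively.\<close>

abbreviation proj :: "int \<Rightarrow> int \<Rightarrow> (4, 2) vector_graph \<Rightarrow> 4 \<Rightarrow> int multiset" where
  "proj a b G i \<equiv> image_mset (\<lambda>p. a * p $ 1 + b * p $ 2) (sources G i)"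

text \<open>
  Each projection contracts one edge vector: it kills the corresponding entry of every vertex cut,
  so the two cut equations become first-order difference equations for the remaining edge vectors.
\<close>

lemma balanced_proj:
  assumes "balanced G"
  shows "proj 1 1 G 1 = proj 1 1 G 3" "proj 1 1 G 2 = proj 1 1 G 3"
    and "proj 1 (-1) G 1 = proj 1 (-1) G 4"
    and "proj 1 0 G 3 = proj 1 0 G 4"
    and "proj 1 0 G 1 + shift 1 (proj 1 0 G 1) = proj 1 0 G 3 + proj 1 0 G 3"
    and "proj 0 1 G 4 = shift 1 (proj 0 1 G 3)"
    and "proj 0 1 G 2 + shift 1 (proj 0 1 G 2) = proj 0 1 G 3 + proj 0 1 G 3"
proof -
  have lin: "image_mset (\<lambda>p. a * p $ 1 + b * p $ 2) (shift s A) =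
      shift (a * s $ 1 + b * s $ 2) (image_mset (\<lambda>p. a * p $ 1 + b * p $ 2) A)"
    for a b and s :: "int ^ 2" and A
    by (rule linear_image_shift) (simp add: algebra_simps)
  have e1: "proj a b G 1 + shift (a + b) (proj a b G 3) + shift (a - b) (proj a b G 4) =
      shift (2 * a) (proj a b G 1) + proj a b G 3 + proj a b G 4" for a b
    using arg_cong[OF conjunct1[OF assms[unfolded balanced_iff_sources]], of "image_mset (\<lambda>p. a * p $ 1 + b * p $ 2)"]
    unfolding image_mset_union lin by (simp add: mult.commute)
  have e2: "proj a b G 2 + shift (a + b) (proj a b G 3) + proj a b G 4 =
      shift (2 * b) (proj a b G 2) + proj a b G 3 + shift (a - b) (proj a b G 4)" for a b
    using arg_cong[OF conjunct2[OF assms[unfolded balanced_iff_sources]], of "image_mset (\<lambda>p. a * p $ 1 + b * p $ 2)"]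
    unfolding image_mset_union lin by (simp add: mult.commute)
  show "proj 1 1 G 1 = proj 1 1 G 3"
    by (rule shift_cancel[of _ 2]) (use e1[of 1 1] in simp_all)
  show "proj 1 1 G 2 = proj 1 1 G 3"
    by (rule shift_cancel[of _ 2]) (use e2[of 1 1] in simp_all)
  show "proj 1 (-1) G 1 = proj 1 (-1) G 4"
    by (rule shift_cancel[of _ 2]) (use e1[of 1 "-1"] in simp_all)
  show x: "proj 1 0 G 3 = proj 1 0 G 4"
    by (rule shift_cancel[of _ 1]) (use e2[of 1 0] in \<open>simp_all add: ac_simps\<close>)
  \<comment> \<open>With \<open>T\<close> the shift by 1, the cut equation reads
    \<open>(1 - T^2) A = 2 (1 - T) C\<close>; cancelling \<open>1 - T\<close> leaves
    \<open>(1 + T) A = 2 C\<close>.\<close>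
  show "proj 1 0 G 1 + shift 1 (proj 1 0 G 1) = proj 1 0 G 3 + proj 1 0 G 3"
    by (rule shift_cancel[of _ 1])
       (use e1[of 1 0] x in \<open>simp_all add: ac_simps\<close>)
  have "shift (-1) (proj 0 1 G 4) = proj 0 1 G 3"
    by (rule shift_cancel[of _ 1]) (use e1[of 0 1] in \<open>simp_all add: ac_simps\<close>)
  from this[symmetric] show y: "proj 0 1 G 4 = shift 1 (proj 0 1 G 3)"
    by simp
  show "proj 0 1 G 2 + shift 1 (proj 0 1 G 2) = proj 0 1 G 3 + proj 0 1 G 3"
    by (rule shift_cancel[of _ 1])
       (use e2[of 0 1] y in \<open>simp_all add: ac_simps\<close>)
qed

text \<open>Projections preserve size, so the projection identities make all edge vectors occur
  equally often.\<close>

lemma balanced_uniform: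
  assumes "balanced G"
  shows "edge_multiplicity G (size (sources G 1))"
proof -
  have "size (sources G 3) = size (sources G 1)" "size (sources G 2) = size (sources G 3)"
      "size (sources G 4) = size (sources G 1)"
    using balanced_proj(1-3)[OF assms, THEN arg_cong[of _ _ size]] by simp_all
  then show ?thesis by (simp add: size_sources forall_4)
qed

lemma size_edge_multiplicity:
  fixes G :: "(4, 2) vector_graph"
  assumes "edge_multiplicity G m"
  shows "size G = 4 * m"
proof -
  have "size G = (\<Sum>i\<in>UNIV. size (sources G i))"
    unfolding sources_def size_image_mset
  proof (induction G)
    case (add e G)
    then show ?case
      by (simp add: sum_4) (use exhaust_4[of "snd e"] in auto)
  qed simp
  then show ?thesis using assms by (simp add: size_sources)
qed

lemma size_2_msetE:
  assumes "size A = 2" obtains a b where "A = {#a, b#}"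
proof -
  obtain a A' where A: "A = add_mset a A'"
    using assms size_eq_Suc_imp_eq_union[of A 1] by (auto simp: numeral_2_eq_2)
  then have "size A' = 1" using assms by simp
  then obtain b where "A' = {#b#}" using size_1_singleton_mset by blast
  with A that show thesis by blast
qed

text \<open>On the right every multiplicity is even; if \<open>a\<close> and \<open>b\<close>
  differed, the smaller would occur exactly once on the left.\<close>

lemma double_pair:
  fixes a b c d :: int
  assumes "{#a, b, a + 1, b + 1#} = {#c, d, c, d#}"
  shows "a = b \<and> (c = a \<and> d = a + 1 \<or> d = a \<and> c = a + 1)"
proof -
  have c: "count {#a, b, a + 1, b + 1#} x = 2 * count {#c, d#} x" for x
    unfolding assms by simp
  then have ev: "even (count {#a, b, a + 1, b + 1#} x)" for x
    by (metis dvd_triv_left)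
  have "\<not> a < b" using ev[of a] by auto
  moreover have "\<not> b < a" using ev[of b] by auto
  ultimately have ab: "a = b" by simp
  show ?thesis
    using c[of a] c[of "a + 1"] by (auto simp: ab split: if_splits)
qed

lemma double_pair_single:
  fixes a c :: int
  assumes "{#a, a + 1#} = {#c, c#}"
  shows False
  using assms by (auto simp: add_eq_conv_ex)


subsection \<open>The two Kirchhoff graphs of multiplicity two\<close>

definition cell_graph :: "(4, 2) vector_graph" where
  "cell_graph = {#(grid 0 0, 1), (grid 0 0, 1), (grid 0 1, 2), (grid 0 1, 2),
     (grid 0 0, 3), (grid 0 1, 3), (grid 0 0, 4), (grid 1 0, 4)#}"

definition plus_graph :: "(4, 2) vector_graph" where
  "plus_graph = {#(grid 1 0, 1), (grid 0 1, 1), (grid 0 1, 2), (grid 1 2, 2),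
     (grid 0 1, 3), (grid 1 1, 3), (grid 1 0, 4), (grid 1 1, 4)#}"

lemma sources_cell_graph:
  "sources cell_graph 1 = {#grid 0 0, grid 0 0#}" "sources cell_graph 2 = {#grid 0 1, grid 0 1#}"
  "sources cell_graph 3 = {#grid 0 0, grid 0 1#}" "sources cell_graph 4 = {#grid 0 0, grid 1 0#}"
  by (simp_all add: sources_def cell_graph_def)

lemma sources_plus_graph:
  "sources plus_graph 1 = {#grid 1 0, grid 0 1#}" "sources plus_graph 2 = {#grid 0 1, grid 1 2#}"
  "sources plus_graph 3 = {#grid 0 1, grid 1 1#}" "sources plus_graph 4 = {#grid 1 0, grid 1 1#}"
  by (simp_all add: sources_def plus_graph_def)

lemma balanced_cell_graph: "balanced cell_graph"
  by (simp add: balanced_iff_sources sources_cell_graph add_mset_commute)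

lemma balanced_plus_graph: "balanced plus_graph"
  by (simp add: balanced_iff_sources sources_plus_graph add_mset_commute)

text \<open>Besides two triangles, a cell contains a quadrilateral formed by both diagonals and both
  \<open>s\<^sub>4\<close> sides.\<close>

lemma cycle_rich_cell:
  assumes "{(grid i j, 1), (grid i (j + 1), 2), (grid i j, 3), (grid i j, 4), (grid (i + 1) j, 4)}
    \<subseteq> set_mset G"
  shows "cycle_rich G"
proof -
  let ?w = "[fwd i j 1, bwd (i + 1) j 4, bwd i (j + 1) 2, bwd i j 4]"
  have "is_cycle R\<^sub>1 G ?w" "cycle_vector ?w $ 1 \<noteq> 0" "cycle_vector ?w $ 2 \<noteq> 0"
    using assms
    by (auto simp: is_cycle_def fwd_def bwd_def edge_copies_def less_Suc_eq cycle_vector_def)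
  moreover have "is_cycle R\<^sub>1 G (triangle_234 i j)" "is_cycle R\<^sub>1 G (triangle_134 i j)"
    using assms by (auto intro: is_cycle_triangle_234 is_cycle_triangle_134)
  ultimately show ?thesis unfolding cycle_rich_def by blast
qed

text \<open>Two triangles share an \<open>s\<^sub>4\<close> edge; the outline of their union uses
  both \<open>s\<^sub>1\<close> and \<open>s\<^sub>2\<close>.\<close>

lemma cycle_rich_roof:
  assumes "{(grid i j, 1), (grid (i + 1) (j + 1), 2), (grid i j, 3), (grid (i + 1) j, 3),
    (grid (i + 1) j, 4)} \<subseteq> set_mset G"
  shows "cycle_rich G"
proof -
  let ?w = "[fwd i j 1, fwd (i + 1) (j + 1) 2, bwd (i + 1) j 3, bwd i j 3]"
  have "is_cycle R\<^sub>1 G ?w" "cycle_vector ?w $ 1 \<noteq> 0" "cycle_vector ?w $ 2 \<noteq> 0"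
    using assms
    by (auto simp: is_cycle_def fwd_def bwd_def edge_copies_def less_Suc_eq cycle_vector_def)
  moreover have "is_cycle R\<^sub>1 G (triangle_234 (i + 1) j)" "is_cycle R\<^sub>1 G (triangle_134 i j)"
    using assms by (auto intro: is_cycle_triangle_234 is_cycle_triangle_134)
  ultimately show ?thesis unfolding cycle_rich_def by blast
qed

lemma kirchhoff_cell_graph: "kirchhoff_graph R\<^sub>1 cell_graph"
  by (rule kirchhoffI[OF balanced_cell_graph cycle_rich_cell[of 0 0]]) (simp add: cell_graph_def)

lemma kirchhoff_plus_graph: "kirchhoff_graph R\<^sub>1 plus_graph"
  by (rule kirchhoffI[OF balanced_plus_graph cycle_rich_roof[of 0 1]]) (simp add: plus_graph_def)

lemma edge_multiplicity_cell_graph: "edge_multiplicity cell_graph 2"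
  by (simp add: size_sources forall_4 sources_cell_graph)

lemma edge_multiplicity_plus_graph: "edge_multiplicity plus_graph 2"
  by (simp add: size_sources forall_4 sources_plus_graph)

lemma pair_mset_eq_iff: "{#a, b#} = {#c, d#} \<longleftrightarrow> a = c \<and> b = d \<or> a = d \<and> b = c"
  by (auto simp: add_eq_conv_ex)

lemma not_translation_cell_plus: "(cell_graph, plus_graph) \<notin> translation_rel"
proof
  assume "(cell_graph, plus_graph) \<in> translation_rel"
  then obtain x where "plus_graph = translate x cell_graph"
    by (auto simp: translation_rel_def)
  from arg_cong[OF this, of "\<lambda>G. sources G 1"] show False
    unfolding sources_translate by (auto simp: sources_cell_graph sources_plus_graph pair_mset_eq_iff) (metis grid_eq_iff zero_neq_one)
qed

lemma image_mset_eq_pairE: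
  assumes "image_mset f A = {#x, y#}"
  obtains a b where "A = {#a, b#}" "f a = x" "f b = y"
  using assms by (auto dest!: msed_map_invR)

text \<open>Contracting \<open>s\<^sub>2\<close> would equate a pair of consecutive integers with a
  doubled one.\<close>

lemma no_multiplicity_1:
  assumes "balanced G" shows "\<not> edge_multiplicity G 1"
proof
  assume "edge_multiplicity G 1"
  then have "size (sources G 1) = 1" "size (sources G 3) = 1" by (simp_all add: size_sources)
  then obtain a c where "sources G 1 = {#a#}" "sources G 3 = {#c#}"
    using size_1_singleton_mset by metis
  then show False
    using balanced_proj(5)[OF assms] double_pair_single[of "a $ 1" "c $ 1"]
    by (simp add: add_mset_commute)
qed

text \<open>The projections fix the coordinates of the sources up to their pairing. Whether the two
  \<open>s\<^sub>3\<close> edges are displaced by \<open>s\<^sub>3\<close> or by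
  \<open>s\<^sub>4\<close> then decides between plus and cell.\<close>

lemma multiplicity_2_cases:
  assumes G: "balanced G" and m: "edge_multiplicity G 2"
  shows "\<exists>x. G = translate x cell_graph \<or> G = translate x plus_graph"
proof -
  note p = balanced_proj[OF G]
  have size: "size (sources G i) = 2" for i using m by (simp add: size_sources)
  obtain a a' where s1: "sources G 1 = {#a, a'#}" using size size_2_msetE by blast
  obtain b b' where s2: "sources G 2 = {#b, b'#}" using size size_2_msetE by blast
  obtain c0 c0' where s0: "sources G 3 = {#c0, c0'#}" using size size_2_msetE by blast
  have "{#a $ 1, a' $ 1, a $ 1 + 1, a' $ 1 + 1#} = {#c0 $ 1, c0' $ 1, c0 $ 1, c0' $ 1#}"
    using p(5) by (simp add: s1 s0 add_mset_commute)
  note x0 = double_pair[OF this]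
  then have a: "a' $ 1 = a $ 1" by simp
  have x3: "proj 1 0 G 3 = {#a $ 1, a $ 1 + 1#}"
    using x0 by (auto simp: s0 add_mset_commute)
  then obtain c c' where s3: "sources G 3 = {#c, c'#}" and c: "c $ 1 = a $ 1" "c' $ 1 = a $ 1 + 1"
    by (rule image_mset_eq_pairE) simp
  have "proj 1 0 G 4 = {#a $ 1, a $ 1 + 1#}" using x3 p(4) by simp
  then obtain d d' where s4: "sources G 4 = {#d, d'#}" and x: "d $ 1 = a $ 1" "d' $ 1 = a $ 1 + 1"
    by (rule image_mset_eq_pairE) simp
  have "{#b $ 2, b' $ 2, b $ 2 + 1, b' $ 2 + 1#} = {#c $ 2, c' $ 2, c $ 2, c' $ 2#}"
    using p(7) by (simp add: s2 s3 add_mset_commute)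
  note y0 = double_pair[OF this]
  have b: "b' $ 2 = b $ 2"
      and y: "c $ 2 = b $ 2 \<and> c' $ 2 = b $ 2 + 1 \<or> c' $ 2 = b $ 2 \<and> c $ 2 = b $ 2 + 1"
    using y0 by auto
  have d: "d $ 2 = c $ 2 + 1 \<and> d' $ 2 = c' $ 2 + 1 \<or> d $ 2 = c' $ 2 + 1 \<and> d' $ 2 = c $ 2 + 1"
    using p(6) by (simp add: s3 s4 pair_mset_eq_iff)
  have u: "a $ 1 + a $ 2 = c $ 1 + c $ 2 \<and> a' $ 1 + a' $ 2 = c' $ 1 + c' $ 2 \<or>
      a $ 1 + a $ 2 = c' $ 1 + c' $ 2 \<and> a' $ 1 + a' $ 2 = c $ 1 + c $ 2"
    using p(1) by (simp add: s1 s3 pair_mset_eq_iff)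
  have u': "b $ 1 + b $ 2 = c $ 1 + c $ 2 \<and> b' $ 1 + b' $ 2 = c' $ 1 + c' $ 2 \<or>
      b $ 1 + b $ 2 = c' $ 1 + c' $ 2 \<and> b' $ 1 + b' $ 2 = c $ 1 + c $ 2"
    using p(2) by (simp add: s2 s3 pair_mset_eq_iff)
  have v: "a $ 1 - a $ 2 = d $ 1 - d $ 2 \<and> a' $ 1 - a' $ 2 = d' $ 1 - d' $ 2 \<or>
      a $ 1 - a $ 2 = d' $ 1 - d' $ 2 \<and> a' $ 1 - a' $ 2 = d $ 1 - d $ 2"
    using p(3) by (simp add: s1 s4 pair_mset_eq_iff)
  note eqs = sources_eq_iff forall_4 sources_translate s1 s2 s3 s4 sources_cell_graph
    sources_plus_graph shift_simps pair_mset_eq_iff vec_eq_iff forall_2 vector_add_component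
    vector_minus_component grid_nth
  show ?thesis
    using y
  proof
    assume y: "c $ 2 = b $ 2 \<and> c' $ 2 = b $ 2 + 1"
    \<comment> \<open>\<open>c\<close> is the \<open>s\<^sub>3\<close> source with the smaller first
      coordinate, which is \<open>grid 0 1\<close> in \<open>plus_graph\<close>.\<close>
    have "G = translate (c - grid 0 1) plus_graph"
      unfolding eqs using a c x b y d u u' v by (smt (z3))
    then show ?thesis by blast
  next
    assume y: "c' $ 2 = b $ 2 \<and> c $ 2 = b $ 2 + 1"
    have "G = translate c cell_graph"
      unfolding eqs using a c x b y d u u' v by (smt (z3))
    then show ?thesis by blast
  qed
qed

text \<open>A nonempty proper balanced part of the eight edges would have multiplicity 1.\<close>

lemma prime_if_multiplicity_2:
  assumes G: "kirchhoff_graph R\<^sub>1 G" and m: "edge_multiplicity G 2"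
  shows "prime_kirchhoff R\<^sub>1 G"
  unfolding prime_kirchhoff_def
proof (intro conjI notI)
  assume "\<exists>G\<^sub>1 G\<^sub>2 x. kirchhoff_graph R\<^sub>1 G\<^sub>1 \<and> kirchhoff_graph R\<^sub>1 G\<^sub>2 \<and>
          G\<^sub>1 \<noteq> {#} \<and> G\<^sub>2 \<noteq> {#} \<and> G = graph_sum G\<^sub>1 G\<^sub>2 x"
  then obtain H K x where H: "balanced H" "H \<noteq> {#}" and K: "K \<noteq> {#}" and eq: "G = H + translate x K"
    using kirchhoff_balanced by (auto simp: graph_sum_def)
  define m' where "m' = size (sources H 1)"
  have m': "edge_multiplicity H m'" using balanced_uniform[OF H(1)] by (simp add: m'_def)
  have "size H + size K = 8"
    using size_edge_multiplicity[OF m] by (simp add: eq translate_def)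
  moreover have "size K > 0" using K by (simp add: nonempty_has_size)
  moreover have "size H > 0" using H by (simp add: nonempty_has_size)
  ultimately have "m' = 1" using size_edge_multiplicity[OF m'] by simp
  then show False using m' no_multiplicity_1[OF H(1)] by simp
qed (use G kirchhoff_nonempty in auto)

lemma the_two_kirchhoff_cell_plus: "the_two_kirchhoff R\<^sub>1 2 cell_graph plus_graph"
  unfolding the_two_kirchhoff_def
proof (intro conjI allI impI)
  fix G assume "kirchhoff_graph R\<^sub>1 G \<and> (\<exists>m'\<le>2. edge_multiplicity G m')"
  then obtain m' where G: "kirchhoff_graph R\<^sub>1 G" and m': "m' \<le> 2" "edge_multiplicity G m'" by blast
  have "size G \<noteq> 0" using kirchhoff_nonempty[OF G] by simp
  then have "m' \<noteq> 0" unfolding size_edge_multiplicity[OF m'(2)] by simp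
  moreover have "m' \<noteq> 1" using no_multiplicity_1[OF kirchhoff_balanced[OF G]] m'(2) by auto
  ultimately have "m' = 2" using m'(1) by simp
  then show "(cell_graph, G) \<in> translation_rel \<or> (plus_graph, G) \<in> translation_rel"
    using multiplicity_2_cases[OF kirchhoff_balanced[OF G]] m'(2) by (auto simp: translation_rel_def)
qed (simp_all add: prime_if_multiplicity_2 kirchhoff_cell_graph kirchhoff_plus_graph
    edge_multiplicity_cell_graph edge_multiplicity_plus_graph not_translation_cell_plus)


subsection \<open>The strips\<close>

text \<open>The left cap of the band; together with the right cap at position 0 it forms a single
  cell.\<close>

definition strip_left :: "(4, 2) vector_graph" where
  "strip_left = {#(grid 0 1, 3), (grid 0 2, 3), (grid 1 1, 4), (grid 0 1, 1), (grid 0 2, 2)#}"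

definition strip_right :: "int \<Rightarrow> (4, 2) vector_graph" where
  "strip_right i = {#(grid i 1, 4), (grid i 1, 1), (grid i 2, 2)#}"

text \<open>Column \<open>i\<close>: the apexes \<open>grid i 3\<close> and \<open>grid i 0\<close>,
  each joined to three points of the nearer middle row, and the two \<open>s\<^sub>3\<close> edges
  leaving the column.\<close>

definition strip_block :: "int \<Rightarrow> (4, 2) vector_graph" where
  "strip_block i = {#(grid i 2, 4), (grid (i - 1) 2, 1), (grid i 3, 2),
     (grid i 0, 4), (grid i 0, 1), (grid (i - 1) 1, 2), (grid i 1, 3), (grid i 2, 3)#}"

primrec strip_body :: "nat \<Rightarrow> (4, 2) vector_graph" where
  "strip_body 0 = {#}"
| "strip_body (Suc n) = strip_body n + strip_block (int n + 1)"

text \<open>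
  Place plus graphs on a \<open>n \<times> 2\<close> rectangle of grid points and remove the \<open>n - 1\<close> cell graphs that fit
  inside: what remains is the boundary of the rectangle.
\<close>

definition strip :: "nat \<Rightarrow> (4, 2) vector_graph" where
  "strip n = strip_left + strip_body n + strip_right (int n)"

lemma strip_0: "strip 0 = translate (grid 0 1) cell_graph"
  by (simp add: strip_def strip_left_def strip_right_def cell_graph_def translate_def add_mset_commute)

text \<open>The new pluses are centred at \<open>grid (int n + 1) 1\<close> and
  \<open>grid (int n + 1) 2\<close>. With the old right cap they complete the cell between columns
  \<open>n\<close> and \<open>n + 1\<close>.\<close>

lemma strip_Suc:
  "strip (Suc n) + translate (grid (int n) 1) cell_graph =
     strip n + translate (grid (int n) 0) plus_graph + translate (grid (int n) 1) plus_graph"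
proof -
  have "strip_block (int n + 1) + strip_right (int n + 1) + translate (grid (int n) 1) cell_graph =
     strip_right (int n) + translate (grid (int n) 0) plus_graph + translate (grid (int n) 1) plus_graph"
    by (simp add: strip_block_def strip_right_def cell_graph_def plus_graph_def translate_def
        add_mset_commute add.commute)
  then show ?thesis by (simp add: strip_def ac_simps)
qed

lemma balanced_strip: "balanced (strip n)"
proof (induction n)
  case 0
  show ?case unfolding strip_0 by (intro balanced_translate balanced_cell_graph)
next
  case (Suc n)
  then have "balanced (strip (Suc n) + translate (grid (int n) 1) cell_graph)"
    unfolding strip_Suc by (intro balanced_add balanced_translate balanced_plus_graph)
  then show ?case
    by (rule balanced_add_cancel) (intro balanced_translate balanced_cell_graph)
qed

text \<open>The strip of length 0 is a cell; every longer one contains a roof with apex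
  \<open>grid 1 3\<close>.\<close>

lemma cycle_rich_strip: "cycle_rich (strip n)"
proof (cases n)
  case 0
  show ?thesis
    by (rule cycle_rich_cell[of 0 1]) (simp add: 0 strip_def strip_left_def strip_right_def)
next
  case (Suc m)
  have "e \<in># strip_body n" if "e \<in># strip_block 1" for e
    unfolding Suc using that by (induction m) auto
  then have "e \<in># strip n" if "e \<in># strip_left \<or> e \<in># strip_block 1" for e
    using that by (simp add: strip_def) blast
  then show ?thesis
    by (intro cycle_rich_roof[of 0 2]) (simp add: strip_left_def strip_block_def)
qed

lemma kirchhoff_strip_add: "balanced G \<Longrightarrow> kirchhoff_graph R\<^sub>1 (strip n + G)"
  by (intro kirchhoffI balanced_add balanced_strip cycle_rich_mono[OF cycle_rich_strip[of n]]) simp_all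

lemma kirchhoff_strip: "kirchhoff_graph R\<^sub>1 (strip n)"
  by (intro kirchhoffI balanced_strip cycle_rich_strip)

section \<open>Strips as tilings\<close>

lemma translate_0: "translate 0 G = G"
  by (simp add: multiset_eq_iff count_translate split_paired_all)

lemma translate_translate: "translate x (translate y G) = translate (y + x) G"
  by (simp add: multiset_eq_iff count_translate split_paired_all algebra_simps)

text \<open>\<open>F\<close> and \<open>F'\<close> are known only up to translation, hence the
  offsets \<open>y\<close> and \<open>y'\<close>. Each intermediate graph is a strip plus a balanced
  graph, so it is Kirchhoff.\<close>

lemma strip_in_tilings:
  assumes "F \<in> Fs" "(F, cell_graph) \<in> translation_rel" "F' \<in> Fs" "(F', plus_graph) \<in> translation_rel"
  shows "strip n \<in> tilings R\<^sub>1 Fs"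
proof -
  obtain y y' where y: "cell_graph = translate y F" and y': "plus_graph = translate y' F'"
    using assms by (auto simp: translation_rel_def)
  show ?thesis
  proof (induction n)
    case 0
    show ?case
      using tilings.place[OF assms(1), of R\<^sub>1 "y + grid 0 1"] kirchhoff_strip[of 0]
      by (simp add: strip_0 y translate_translate)
  next
    case (Suc n)
    define P where "P j = translate (grid (int n) j) plus_graph" for j
    have P: "P j = translate (y' + grid (int n) j) F'" for j
      by (simp add: P_def y' translate_translate)
    have bal: "balanced (P j)" for j
      by (simp add: P_def balanced_translate balanced_plus_graph)
    have "strip n + P 0 \<in> tilings R\<^sub>1 Fs"
      using tilings.add[OF Suc assms(3), of "y' + grid (int n) 0"] kirchhoff_strip_add[OF bal]
      by (simp add: graph_sum_def flip: P)
    from tilings.add[OF this assms(3), of "y' + grid (int n) 1"]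
    have sum: "strip n + P 0 + P 1 \<in> tilings R\<^sub>1 Fs"
      using kirchhoff_strip_add[OF balanced_add[OF bal bal]]
      by (simp add: graph_sum_def add.assoc flip: P)
    \<comment> \<open>This shows both that the cell is present and what its removal leaves.\<close>
    have eq: "strip n + P 0 + P 1 = strip (Suc n) + translate (y + grid (int n) 1) F"
      using strip_Suc[of n] by (simp add: P_def y translate_translate)
    show ?case
      using tilings.remove[OF sum assms(1), of "y + grid (int n) 1"] kirchhoff_strip
      unfolding graph_diff_def eq by simp
  qed
qed

section \<open>Edge counts and primality of the strips\<close>

lemma count_strip_body:
  "count (strip_body n) (grid i j, 1) =
     (if j = 2 \<and> 0 \<le> i \<and> i < int n \<or> j = 0 \<and> 1 \<le> i \<and> i \<le> int n then 1 else 0)"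
  "count (strip_body n) (grid i j, 2) =
     (if j = 1 \<and> 0 \<le> i \<and> i < int n \<or> j = 3 \<and> 1 \<le> i \<and> i \<le> int n then 1 else 0)"
  "count (strip_body n) (grid i j, 3) = (if (j = 1 \<or> j = 2) \<and> 1 \<le> i \<and> i \<le> int n then 1 else 0)"
  "count (strip_body n) (grid i j, 4) = (if (j = 0 \<or> j = 2) \<and> 1 \<le> i \<and> i \<le> int n then 1 else 0)"
  by (induction n) (auto simp: strip_block_def)

text \<open>From length 2 on every edge is simple; at length 1 both caps contain the
  \<open>s\<^sub>4\<close> edge at \<open>grid 1 1\<close>.\<close>

lemma count_strip:
  assumes "n \<ge> 2"
  shows "count (strip n) (grid i j, 1) =
     (if j = 2 \<and> 0 \<le> i \<and> i < int n \<or> j = 0 \<and> 1 \<le> i \<and> i \<le> int n \<or> j = 1 \<and> (i = 0 \<or> i = int n)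
      then 1 else 0)"
  and "count (strip n) (grid i j, 2) =
     (if j = 1 \<and> 0 \<le> i \<and> i < int n \<or> j = 3 \<and> 1 \<le> i \<and> i \<le> int n \<or> j = 2 \<and> (i = 0 \<or> i = int n)
      then 1 else 0)"
  and "count (strip n) (grid i j, 3) = (if (j = 1 \<or> j = 2) \<and> 0 \<le> i \<and> i \<le> int n then 1 else 0)"
  and "count (strip n) (grid i j, 4) =
     (if (j = 0 \<or> j = 2) \<and> 1 \<le> i \<and> i \<le> int n \<or> j = 1 \<and> (i = 1 \<or> i = int n) then 1 else 0)"
  using assms by (auto simp: strip_def strip_left_def strip_right_def count_strip_body)

lemma strip_edge_grid:
  assumes "(p, k) \<in># strip n" obtains i j where "p = grid i j"
proof -
  have "\<exists>i j. p = grid i j" if "(p, k) \<in># strip_body m" for m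
    using that by (induction m) (auto simp: strip_block_def)
  then show ?thesis using assms that
    by (auto simp: strip_def strip_left_def strip_right_def)
qed

text \<open>
  The cuts at the top and bottom vertices tie the edges into triangles, those along the two middle
  rows make the multiplicities of the triangles affine in the position, and the vertices at the left
  end fix the common value.
\<close>

lemma balanced_subgraph_strip:
  assumes n: "n \<ge> 2" and H: "balanced H" "H \<subseteq># strip n"
  shows "H = {#} \<or> H = strip n"
proof -
  define h where "h k i j = int (count H (grid i j, k))" for k i j
  have le: "0 \<le> h k i j" "h k i j \<le> int (count (strip n) (grid i j, k))" for k i j
    using mset_subset_eq_count[OF H(2)] by (simp_all add: h_def)
  have le1: "h k i j \<le> 1" for k i j
    using le(2)[of k i j] exhaust_4[of k] by (auto simp: count_strip[OF n] split: if_splits)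
  have z: "h k i j = 0" if "count (strip n) (grid i j, k) = 0" for k i j
    using le[of k i j] that by simp
  note zs = z count_strip[OF n]
  have cut: "h 1 i j - h 1 (i - 1) (j - 1) = h 3 i j - h 3 (i - 1) j + h 4 i j - h 4 i (j - 1)"
      "h 2 i j - h 2 (i - 1) (j + 1) = h 3 i j - h 3 (i - 1) j - h 4 i j + h 4 i (j - 1)" for i j
    using H(1)[unfolded balanced_def Let_def, rule_format, of "grid i j"]
    by (simp_all add: vertex_cut_def h_def)
  \<comment> \<open>Only three edges meet at an apex, and the two cut equations there equate their
    multiplicities.\<close>
  have top: "h 1 (i - 1) 2 = h 4 i 2" "h 2 i 3 = h 4 i 2" if "1 \<le> i" "i \<le> int n" for i
    using that cut[of i 3] by (simp_all add: zs)
  have bot: "h 1 i 0 = h 4 i 0" "h 2 (i - 1) 1 = h 4 i 0" if "1 \<le> i" "i \<le> int n" for i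
    using that cut[of i 0] by (simp_all add: zs)
  \<comment> \<open>All edges of the strip will turn out to have the multiplicity of this inner edge
    of the left cap.\<close>
  define c where "c = h 4 1 1"
  have l1: "h 1 0 1 = h 4 1 0" "h 3 0 1 = h 4 1 0"
    using cut[of 0 1] bot[of 1] n by (simp_all add: zs)
  have l2: "h 2 0 2 = h 4 1 2" "h 3 0 2 = h 4 1 2"
    using cut[of 0 2] top[of 1] n by (simp_all add: zs)
  have m2: "h 1 1 2 - h 1 0 1 = 2 * (h 4 1 2 - c)" "h 3 1 2 - h 3 0 2 = h 4 1 2 - c"
    using cut[of 1 2] n by (simp_all add: zs c_def)
  have m1: "h 2 1 1 - h 2 0 2 = 2 * (h 4 1 0 - c)" "h 3 1 1 - h 3 0 1 = h 4 1 0 - c"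
    using cut[of 1 1] n by (simp_all add: zs c_def)
  have e: "h 4 2 2 - h 4 1 0 = 2 * (h 4 1 2 - c)" "h 4 2 0 - h 4 1 2 = 2 * (h 4 1 0 - c)"
    using m1 m2 l1 l2 top(1)[of 2] bot(2)[of 2] n by simp_all
  \<comment> \<open>Two values in {0, 1} cannot differ by a nonzero even number, so both jumps in
    \<open>e\<close> vanish.\<close>
  have parity: "z = c'" if "x - y = 2 * (z - c')" "0 \<le> x" "x \<le> 1" "0 \<le> y" "y \<le> 1" for x y z c' :: int
    using that by presburger
  have "h 4 1 2 = c" by (rule parity[OF e(1)]) (fact le(1) le1)+
  moreover have "h 4 1 0 = c" by (rule parity[OF e(2)]) (fact le(1) le1)+
  ultimately have start: "h 4 1 2 = c" "h 4 1 0 = c" "h 4 2 2 = c" "h 4 2 0 = c" "h 3 1 2 = c"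
      "h 3 1 1 = c" "h 3 0 2 = c" "h 3 0 1 = c"
    using e m1 m2 l1 l2 by simp_all
  \<comment> \<open>Second differences vanish along the middle rows, a recurrence of order two, so
    two consecutive values are carried along.\<close>
  have triangles: "h 4 (int m + 1) 2 = c \<and> h 4 (int m + 2) 2 = c \<and>
      h 4 (int m + 1) 0 = c \<and> h 4 (int m + 2) 0 = c \<and> h 3 (int m + 1) 2 = c \<and> h 3 (int m + 1) 1 = c"
    if "m + 2 \<le> n" for m
    using that
  proof (induction m)
    case 0
    then show ?case using start by simp
  next
    case (Suc m)
    \<comment> \<open>In the columns \<open>2 \<le> i < n\<close> no cap edge meets the middle
      rows.\<close>
    define i where "i = int m + 2"
    have i: "2 \<le> i" "i < int n" using Suc.prems by (auto simp: i_def)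
    have IH: "h 4 (i - 1) 2 = c" "h 4 i 2 = c" "h 4 (i - 1) 0 = c" "h 4 i 0 = c" "h 3 (i - 1) 2 = c"
        "h 3 (i - 1) 1 = c"
      using Suc by (simp_all add: i_def add.commute)
    have "h 4 (i + 1) 2 = c \<and> h 3 i 2 = c"
      using cut[of i 2] top[of "i + 1"] top[of "i - 1"] IH i by (simp add: zs)
    moreover have "h 4 (i + 1) 0 = c \<and> h 3 i 1 = c"
      using cut[of i 1] bot[of "i + 1"] bot[of "i - 1"] IH i by (simp add: zs)
    ultimately show ?case using IH by (simp add: i_def add.commute)
  qed
  have h4: "h 4 i 2 = c" "h 4 i 0 = c" if i: "1 \<le> i" "i \<le> int n" for i
  proof -
    consider "i < int n" | "i = int n" using i by linarith
    then have "h 4 i 2 = c \<and> h 4 i 0 = c"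
    proof cases
      case 1
      then show ?thesis using triangles[of "nat (i - 1)"] i by simp
    next
      case 2
      then show ?thesis using triangles[of "n - 2"] n by (simp add: of_nat_diff)
    qed
    then show "h 4 i 2 = c" "h 4 i 0 = c" by simp_all
  qed
  \<comment> \<open>The vertices in column \<open>n + 1\<close> tie the right cap to the last
    apexes.\<close>
  have r: "h 1 (int n) 1 = c" "h 3 (int n) 2 = c" "h 2 (int n) 2 = c" "h 3 (int n) 1 = c"
    using cut[of "int n + 1" 2] cut[of "int n + 1" 1] top[of "int n"] bot[of "int n"] h4[of "int n"] n
    by (simp_all add: zs)
  have h3: "h 3 i 2 = c" "h 3 i 1 = c" if i: "0 \<le> i" "i \<le> int n" for i
  proof -
    consider "i = 0" | "1 \<le> i" "i < int n" | "i = int n" using i by linarith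
    then have "h 3 i 2 = c \<and> h 3 i 1 = c"
    proof cases
      case 2
      then show ?thesis using triangles[of "nat (i - 1)"] by simp
    qed (use start r in simp_all)
    then show "h 3 i 2 = c" "h 3 i 1 = c" by simp_all
  qed
  have r4: "h 4 (int n) 1 = c"
    using cut(1)[of "int n" 2] h3[of "int n"] h3[of "int n - 1"] h4[of "int n"] n by (simp add: zs)
  have h12: "h 1 i 2 = c" "h 2 i 1 = c" if "0 \<le> i" "i < int n" for i
    using top(1)[of "i + 1"] bot(2)[of "i + 1"] h4[of "i + 1"] that by simp_all
  have h12': "h 1 i 0 = c" "h 2 i 3 = c" if "1 \<le> i" "i \<le> int n" for i
    using top(2)[of i] bot(1)[of i] h4[of i] that by simp_all
  have ends: "h 1 0 1 = c" "h 2 0 2 = c" "h 4 1 1 = c"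
    using l1 l2 start by (simp_all add: c_def)
  have grid: "count (strip n) (grid i j, k) = 0 \<or> count (strip n) (grid i j, k) = 1 \<and> h k i j = c"
    for i j k
    using exhaust_4[of k]
    by (elim disjE; hypsubst; auto simp: count_strip[OF n] h12 h12' h3 h4 r r4 ends)
  have all: "count H (p, k) = nat c * count (strip n) (p, k)" for p k
  proof (cases "count (strip n) (p, k) = 0")
    case True
    then show ?thesis using mset_subset_eq_count[OF H(2), of "(p, k)"] by simp
  next
    case False
    then obtain i j where p: "p = grid i j" by (meson not_in_iff strip_edge_grid)
    then have "count (strip n) (p, k) = 1" "int (count H (p, k)) = c"
      using grid[of i j k] False by (simp_all only: h_def) blast+
    then show ?thesis by simp
  qed
  \<comment> \<open>Since the strip has only simple edges, \<open>c\<close> decides between the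
    empty graph and the whole strip.\<close>
  have "c = 0 \<or> c = 1" using le[of 4 1 1] le1[of 4 1 1] by (auto simp: c_def)
  then show ?thesis using all by (auto simp: multiset_eq_iff)
qed

lemma prime_strip:
  assumes "n \<ge> 2" shows "prime_kirchhoff R\<^sub>1 (strip n)"
  unfolding prime_kirchhoff_def
proof (intro conjI notI)
  assume "\<exists>G\<^sub>1 G\<^sub>2 x. kirchhoff_graph R\<^sub>1 G\<^sub>1 \<and> kirchhoff_graph R\<^sub>1 G\<^sub>2 \<and>
          G\<^sub>1 \<noteq> {#} \<and> G\<^sub>2 \<noteq> {#} \<and> strip n = graph_sum G\<^sub>1 G\<^sub>2 x"
  then obtain H K x where H: "balanced H" "H \<noteq> {#}" and K: "K \<noteq> {#}"
      and eq: "strip n = H + translate x K"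
    using kirchhoff_balanced by (auto simp: graph_sum_def)
  then have "H = strip n" using balanced_subgraph_strip[OF assms H(1)] by auto
  then show False using eq K by (simp add: translate_def)
qed (use kirchhoff_strip kirchhoff_nonempty in auto)

lemma size_strip: "size (strip n) = 8 * n + 8"
proof -
  have "size (strip_body n) = 8 * n" by (induction n) (simp_all add: strip_block_def)
  then show ?thesis by (simp add: strip_def strip_left_def strip_right_def)
qed

text \<open>Existence is stated separately, so that the second part is not vacuous. Classes modulo
  translation are counted because a single nonempty graph already has infinitely many
  translates.\<close>

theorem theorem3:
  shows "(\<exists>F\<^sub>1 F\<^sub>2. the_two_kirchhoff R\<^sub>1 2 F\<^sub>1 F\<^sub>2) \<and>
    (\<forall>F\<^sub>1 F\<^sub>2. the_two_kirchhoff R\<^sub>1 2 F\<^sub>1 F\<^sub>2 \<longrightarrow>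
       infinite ({G \<in> tilings R\<^sub>1 {F\<^sub>1, F\<^sub>2}. prime_kirchhoff R\<^sub>1 G} // translation_rel))"
proof (intro conjI allI impI)
  show "\<exists>F\<^sub>1 F\<^sub>2. the_two_kirchhoff R\<^sub>1 2 F\<^sub>1 F\<^sub>2"
    using the_two_kirchhoff_cell_plus by blast
next
  fix F\<^sub>1 F\<^sub>2 :: "(4, 2) vector_graph"
  assume two: "the_two_kirchhoff R\<^sub>1 2 F\<^sub>1 F\<^sub>2"
  let ?A = "{G \<in> tilings R\<^sub>1 {F\<^sub>1, F\<^sub>2}. prime_kirchhoff R\<^sub>1 G}"
  \<comment> \<open>Cell and plus have multiplicity 2, so each is a translate of one of the given
    graphs.\<close>
  have "\<exists>F \<in> {F\<^sub>1, F\<^sub>2}. (F, G) \<in> translation_rel"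
    if "kirchhoff_graph R\<^sub>1 G" "edge_multiplicity G 2" for G
    using two that unfolding the_two_kirchhoff_def by blast
  then obtain F F' where "F \<in> {F\<^sub>1, F\<^sub>2}" "(F, cell_graph) \<in> translation_rel"
      "F' \<in> {F\<^sub>1, F\<^sub>2}" "(F', plus_graph) \<in> translation_rel"
    using kirchhoff_cell_graph edge_multiplicity_cell_graph kirchhoff_plus_graph
      edge_multiplicity_plus_graph by meson
  then have A: "strip (n + 2) \<in> ?A" for n
    using strip_in_tilings prime_strip by simp
  \<comment> \<open>Lengths start at 2, as \<open>prime_strip\<close> requires. Translates have
    equal size, and the size determines the length.\<close>
  let ?f = "\<lambda>n. translation_rel `` {strip (n + 2)}"
  have "inj ?f"
  proof (rule injI)
    fix m n :: nat
    assume "?f m = ?f n"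
    moreover have "strip (n + 2) \<in> ?f n"
      by (auto simp: translation_rel_def translate_0 intro!: exI[of _ 0])
    ultimately have "(strip (m + 2), strip (n + 2)) \<in> translation_rel" by auto
    then have "size (strip (n + 2)) = size (strip (m + 2))"
      by (auto simp: translation_rel_def translate_def)
    then show "m = n" by (simp add: size_strip)
  qed
  moreover have "range ?f \<subseteq> ?A // translation_rel"
    using A by (auto simp: quotient_def)
  ultimately show "infinite (?A // translation_rel)"
    using infinite_super range_inj_infinite by blast
qed

end
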